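(* (i) Let $n_0 = \left(9 \times 11 \times 16 \times 17 \times 19 \times 23\right)^2$ (which is approximately $1.4 \times 10^{14}$). Then for every integer $n \geq n_0$ there exists a permutation of $\mathbb{Z}_n$ destroying arithmetic progressions. (ii) For every $s, t \in \mathbb{N}_0$ there is an $n_0(s,t)$ such that for every integer $n \geq n_0(s,t)$ there exists a permutation of $\mathbb{Z}_n$ destroying $(s,t)$-almost APs.
   Context: $\mathbb{Z}_n$ denotes the cyclic group of integers modulo $n$, and $\mathbb{N}_0$ the set of non-negative integers. A permutation of $\mathbb{Z}_n$ is a bijection $\mathbb{Z}_n \to \mathbb{Z}_n$ (not required to be a homomorphism). A permutation $\pi$ of $\mathbb{Z}_n$ is said to destroy arithmetic progressions (APs) if there is no triple $(a,b,c)$ of elements of $\mathbb{Z}_n$ satisfying all of: $a,b,c$ are not all equal; $c-b = b-a$ in $\mathbb{Z}_n$; and $\pi(c)-\pi(b) = \pi(b)-\pi(a)$ in $\mathbb{Z}_n$. For $s,t \in \mathbb{N}_0$, a permutation $\pi$ of $\mathbb{Z}_n$ is said to destroy $(s,t)$-almost APs if there is no triple $(a,b,c)$ of elements of $\mathbb{Z}_n$ satisfying all of: $a,b,c$ are not all equal; $a+c-2b \equiv \eta_1 \pmod n$ for some $\eta_1 \in \{0,\pm 1,\dots,\pm s\}$; and $\pi(a)+\pi(c)-2\pi(b) \equiv \eta_2 \pmod n$ for some $\eta_2 \in \{0,\pm 1,\dots,\pm t\}$. *)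

theory Defs
  imports "HOL-Number_Theory.Cong" "HOL-Algebra.Elementary_Groups"
begin

text \<open>
  The elements of \<open>\<int>\<^sub>n\<close> are the residues in \<open>carrier (integer_mod_group n)\<close>, i.e.\ \<open>{0..<int n}\<close> for
  \<open>n > 0\<close>. Sums and differences below are taken in \<open>int\<close>; an equation in \<open>\<int>\<^sub>n\<close> is a congruence
  modulo \<open>n\<close>. The values of \<open>\<pi>\<close> outside the carrier are irrelevant.
\<close>

definition permutation_Zn :: "nat \<Rightarrow> (int \<Rightarrow> int) \<Rightarrow> bool" where
  "permutation_Zn n \<pi> \<longleftrightarrow>
     bij_betw \<pi> (carrier (integer_mod_group n)) (carrier (integer_mod_group n))"

definition destroys_APs :: "nat \<Rightarrow> (int \<Rightarrow> int) \<Rightarrow> bool" where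
  "destroys_APs n \<pi> \<longleftrightarrow>
     \<not> (\<exists>a \<in> carrier (integer_mod_group n).
         \<exists>b \<in> carrier (integer_mod_group n).
         \<exists>c \<in> carrier (integer_mod_group n).
           \<not> (a = b \<and> b = c) \<and>
           [c - b = b - a] (mod int n) \<and>
           [\<pi> c - \<pi> b = \<pi> b - \<pi> a] (mod int n))"

definition destroys_almost_APs :: "nat \<Rightarrow> nat \<Rightarrow> nat \<Rightarrow> (int \<Rightarrow> int) \<Rightarrow> bool" where
  "destroys_almost_APs s t n \<pi> \<longleftrightarrow>
     \<not> (\<exists>a \<in> carrier (integer_mod_group n).
         \<exists>b \<in> carrier (integer_mod_group n).
         \<exists>c \<in> carrier (integer_mod_group n).
           \<not> (a = b \<and> b = c) \<and>
           (\<exists>\<eta>1 \<in> {- int s..int s}. [a + c - 2 * b = \<eta>1] (mod int n)) \<and>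
           (\<exists>\<eta>2 \<in> {- int t..int t}. [\<pi> a + \<pi> c - 2 * \<pi> b = \<eta>2] (mod int n)))"

end

theory Submission
  imports Defs
begin

text \<open>
  Cut \<open>\<int>\<^sub>n\<close> into \<open>k\<close> intervals of nearly equal length, \<open>n\<close> being large compared with \<open>k\<^sup>2\<close>. The indices
  of the intervals containing an almost progression form a \<open>(2,2)\<close>-almost progression in \<open>\<int>\<^sub>k\<close>, so if
  the intervals are permuted by a permutation of \<open>\<int>\<^sub>k\<close> destroying those, only progressions inside one
  interval remain, and these are progressions of integers, which are easy to destroy. A suitable \<open>k\<close> is
  obtained from small permutations by the Chinese remainder theorem: in a product it suffices that
  every factor destroys exact progressions and each pair \<open>(\<eta>\<^sub>1, \<eta>\<^sub>2)\<close> of second differences is excluded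
  by some factor.

  For arbitrary \<open>s\<close> and \<open>t\<close>, the same product argument is applied to many large primes, each of which
  excludes one pair after scaling by units. For integer intervals, residue classes take the place of
  the subintervals in the domain: modulo \<open>k > s\<close> this reduces the first tolerance to \<open>0\<close>, and passing to
  inverses exchanges the two tolerances.
\<close>

section \<open>Avoiding prescribed pairs of second differences\<close>

text \<open>A set of pairs rather than two tolerances, because the product construction divides the
  pairs of a box among its factors. A constant triple has second differences 0, so a pair in
  \<open>E\<close> that is not \<open>(0, 0)\<close> modulo \<open>n\<close> must not occur at
  all.\<close>

definition avoids_mod :: "int \<Rightarrow> (int \<times> int) set \<Rightarrow> (int \<Rightarrow> int) \<Rightarrow> bool" where
  "avoids_mod n E \<pi> \<longleftrightarrow> bij_betw \<pi> {0..<n} {0..<n} \<and>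
     (\<forall>a\<in>{0..<n}. \<forall>b\<in>{0..<n}. \<forall>c\<in>{0..<n}. \<forall>(x, y)\<in>E.
        [a + c - 2 * b = x] (mod n) \<longrightarrow> [\<pi> a + \<pi> c - 2 * \<pi> b = y] (mod n) \<longrightarrow> a = b \<and> b = c)"

definition avoids_int :: "int \<Rightarrow> int \<Rightarrow> int \<Rightarrow> (int \<Rightarrow> int) \<Rightarrow> bool" where
  "avoids_int n s t \<pi> \<longleftrightarrow> bij_betw \<pi> {0..<n} {0..<n} \<and>
     (\<forall>a\<in>{0..<n}. \<forall>b\<in>{0..<n}. \<forall>c\<in>{0..<n}.
        \<bar>a + c - 2 * b\<bar> \<le> s \<longrightarrow> \<bar>\<pi> a + \<pi> c - 2 * \<pi> b\<bar> \<le> t \<longrightarrow> a = b \<and> b = c)"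

abbreviation box :: "int \<Rightarrow> int \<Rightarrow> (int \<times> int) set" where
  "box s t \<equiv> {- s..s} \<times> {- t..t}"

lemma avoids_mod_bij: "avoids_mod n E \<pi> \<Longrightarrow> bij_betw \<pi> {0..<n} {0..<n}"
  by (simp add: avoids_mod_def)

lemma avoids_int_bij: "avoids_int n s t \<pi> \<Longrightarrow> bij_betw \<pi> {0..<n} {0..<n}"
  by (simp add: avoids_int_def)

lemma avoids_modD:
  assumes "avoids_mod n E \<pi>" "a \<in> {0..<n}" "b \<in> {0..<n}" "c \<in> {0..<n}" "(x, y) \<in> E"
    "[a + c - 2 * b = x] (mod n)" "[\<pi> a + \<pi> c - 2 * \<pi> b = y] (mod n)"
  shows "a = b \<and> b = c"
  using assms unfolding avoids_mod_def by blast

lemma avoids_modI: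
  assumes "bij_betw \<pi> {0..<n} {0..<n}"
    "\<And>a b c x y. a \<in> {0..<n} \<Longrightarrow> b \<in> {0..<n} \<Longrightarrow> c \<in> {0..<n} \<Longrightarrow> (x, y) \<in> E \<Longrightarrow>
       [a + c - 2 * b = x] (mod n) \<Longrightarrow> [\<pi> a + \<pi> c - 2 * \<pi> b = y] (mod n) \<Longrightarrow> a = b \<and> b = c"
  shows "avoids_mod n E \<pi>"
  using assms unfolding avoids_mod_def by blast

lemma avoids_intD:
  assumes "avoids_int n s t \<pi>" "a \<in> {0..<n}" "b \<in> {0..<n}" "c \<in> {0..<n}"
    "\<bar>a + c - 2 * b\<bar> \<le> s" "\<bar>\<pi> a + \<pi> c - 2 * \<pi> b\<bar> \<le> t"
  shows "a = b \<and> b = c"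
  using assms unfolding avoids_int_def by blast

lemma avoids_intI:
  assumes "bij_betw \<pi> {0..<n} {0..<n}"
    "\<And>a b c. a \<in> {0..<n} \<Longrightarrow> b \<in> {0..<n} \<Longrightarrow> c \<in> {0..<n} \<Longrightarrow>
       \<bar>a + c - 2 * b\<bar> \<le> s \<Longrightarrow> \<bar>\<pi> a + \<pi> c - 2 * \<pi> b\<bar> \<le> t \<Longrightarrow> a = b \<and> b = c"
  shows "avoids_int n s t \<pi>"
  using assms unfolding avoids_int_def by blast

lemma avoids_mod_mono: "avoids_mod n E \<pi> \<Longrightarrow> F \<subseteq> E \<Longrightarrow> avoids_mod n F \<pi>"
  unfolding avoids_mod_def by blast

lemma avoids_mod_imp_destroys:
  assumes "avoids_mod (int n) (box (int s) (int t)) \<pi>" "n > 0"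
  shows "permutation_Zn n \<pi>" "destroys_almost_APs s t n \<pi>"
proof -
  \<comment> \<open>For \<open>n = 0\<close> the carrier would be all of the integers.\<close>
  have car: "carrier (integer_mod_group n) = {0..<int n}"
    using \<open>n > 0\<close> by (simp add: integer_mod_group_def)
  show "permutation_Zn n \<pi>"
    using assms(1) by (simp add: permutation_Zn_def car avoids_mod_bij)
  show "destroys_almost_APs s t n \<pi>"
    unfolding destroys_almost_APs_def car using avoids_modD[OF assms(1)] by blast
qed

lemma destroys_almost_APs_0_imp_destroys_APs:
  assumes "destroys_almost_APs 0 0 n \<pi>"
  shows "destroys_APs n \<pi>"
proof -
  have *: "[x + z - 2 * y = 0] (mod m)" if "[z - y = y - x] (mod m)" for x y z m :: int
    using that by (simp add: cong_iff_dvd_diff algebra_simps)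
  show ?thesis
    using assms unfolding destroys_almost_APs_def destroys_APs_def
    by (force dest: *)
qed

lemma cong_eq_int: "x \<in> {0..<n} \<Longrightarrow> y \<in> {0..<n} \<Longrightarrow> [x = y] (mod n) \<Longrightarrow> x = (y :: int)"
  by (simp add: cong_def)

lemma cong_mod_mod_mod:
  fixes a b c n :: int
  shows "[a mod n + c mod n - 2 * (b mod n) = a + c - 2 * b] (mod n)"
  by (intro cong_diff cong_add cong_mult) (simp_all add: cong_def)

lemma bij_betw_if_inj_on_interval:
  fixes f :: "int \<Rightarrow> int"
  assumes "\<And>x. x \<in> {0..<n} \<Longrightarrow> f x \<in> {0..<n}" "inj_on f {0..<n}"
  shows "bij_betw f {0..<n} {0..<n}"
  using assms by (simp add: bij_betw_def endo_inj_surj image_subset_iff)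

text \<open>The Chinese remainder theorem glues the two permutations. A pair in \<open>E\<close>
  makes a triple constant modulo \<open>m\<close>, so both its entries are 0 modulo \<open>m\<close>
  and, being small, equal to 0. The pair \<open>(0, 0)\<close> lies in \<open>F\<close> too, so the
  triple is also constant modulo \<open>n\<close>; the roles of the factors can be
  exchanged.\<close>

lemma avoids_mod_product:
  assumes "coprime m n" "m > 0" "n > 0"
    and \<pi>: "avoids_mod m E \<pi>" and \<rho>: "avoids_mod n F \<rho>"
    and 0: "(0, 0) \<in> E" "(0, 0) \<in> F"
    and E: "\<And>x y. (x, y) \<in> E \<Longrightarrow> \<bar>x\<bar> < m \<and> \<bar>y\<bar> < m"
    and F: "\<And>x y. (x, y) \<in> F \<Longrightarrow> \<bar>x\<bar> < n \<and> \<bar>y\<bar> < n"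
  shows "\<exists>\<sigma>. avoids_mod (m * n) (E \<union> F) \<sigma>"
proof -
  have "\<exists>z\<in>{0..<m * n}. [z = \<pi> (x mod m)] (mod m) \<and> [z = \<rho> (x mod n)] (mod n)" for x
  proof -
    obtain z where "[z = \<pi> (x mod m)] (mod m)" "[z = \<rho> (x mod n)] (mod n)"
      using binary_chinese_remainder_int[OF \<open>coprime m n\<close>] by blast
    then have "[z mod (m * n) = \<pi> (x mod m)] (mod m)" "[z mod (m * n) = \<rho> (x mod n)] (mod n)"
      by (simp_all add: cong_def mod_mult2_eq' mod_mod_cancel)
    moreover have "z mod (m * n) \<in> {0..<m * n}"
      using assms by simp
    ultimately show ?thesis by blast
  qed
  then obtain \<sigma> where \<sigma>: "\<And>x. \<sigma> x \<in> {0..<m * n}"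
    and \<sigma>m: "\<And>x. [\<sigma> x = \<pi> (x mod m)] (mod m)" and \<sigma>n: "\<And>x. [\<sigma> x = \<rho> (x mod n)] (mod n)"
    by metis
  have eqI: "x = y" if "x \<in> {0..<m * n}" "y \<in> {0..<m * n}" "x mod m = y mod m" "x mod n = y mod n"
    for x y
  proof -
    have "[x = y] (mod m * n)"
      using that \<open>coprime m n\<close> by (intro coprime_cong_mult) (simp_all add: cong_def)
    then show ?thesis using that cong_eq_int by blast
  qed
  have inm: "x mod m \<in> {0..<m}" and inn: "x mod n \<in> {0..<n}" for x
    using assms by simp_all
  have "bij_betw \<sigma> {0..<m * n} {0..<m * n}"
  proof (intro bij_betw_if_inj_on_interval \<sigma> inj_onI)
    fix x y assume xy: "x \<in> {0..<m * n}" "y \<in> {0..<m * n}" "\<sigma> x = \<sigma> y"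
    have "[\<pi> (x mod m) = \<pi> (y mod m)] (mod m)" "[\<rho> (x mod n) = \<rho> (y mod n)] (mod n)"
      using \<sigma>m[of x] \<sigma>m[of y] \<sigma>n[of x] \<sigma>n[of y] xy(3) by (metis cong_sym cong_trans)+
    then have "\<pi> (x mod m) = \<pi> (y mod m)" "\<rho> (x mod n) = \<rho> (y mod n)"
      using bij_betwE[OF avoids_mod_bij[OF \<pi>]] bij_betwE[OF avoids_mod_bij[OF \<rho>]] inm inn
      by (blast intro: cong_eq_int)+
    then have "x mod m = y mod m" "x mod n = y mod n"
      using bij_betw_imp_inj_on[OF avoids_mod_bij[OF \<pi>]] bij_betw_imp_inj_on[OF avoids_mod_bij[OF \<rho>]]
        inm inn by (meson inj_onD)+
    then show "x = y" using eqI xy by blast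
  qed
  moreover have "a = b \<and> b = c"
    if abc: "a \<in> {0..<m * n}" "b \<in> {0..<m * n}" "c \<in> {0..<m * n}" and "(x, y) \<in> E \<union> F"
      and 1: "[a + c - 2 * b = x] (mod m * n)" and 2: "[\<sigma> a + \<sigma> c - 2 * \<sigma> b = y] (mod m * n)"
    for a b c x y
  proof -
    have congs: "[a mod k + c mod k - 2 * (b mod k) = x] (mod k)"
      "[\<tau> (a mod k) + \<tau> (c mod k) - 2 * \<tau> (b mod k) = y] (mod k)"
      if k: "k dvd m * n" and \<tau>: "\<And>x. [\<sigma> x = \<tau> (x mod k)] (mod k)" for k \<tau>
    proof -
      show "[a mod k + c mod k - 2 * (b mod k) = x] (mod k)"
        using cong_trans[OF cong_mod_mod_mod cong_dvd_modulus[OF 1 k]] .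
      have "[\<sigma> a + \<sigma> c - 2 * \<sigma> b = \<tau> (a mod k) + \<tau> (c mod k) - 2 * \<tau> (b mod k)] (mod k)"
        by (intro cong_diff cong_add cong_mult \<tau>) simp
      then show "[\<tau> (a mod k) + \<tau> (c mod k) - 2 * \<tau> (b mod k) = y] (mod k)"
        using cong_dvd_modulus[OF 2 k] cong_sym cong_trans by blast
    qed
    note cm = congs[of m \<pi>, OF _ \<sigma>m, simplified] and cn = congs[of n \<rho>, OF _ \<sigma>n, simplified]
    have zero: "x = 0 \<and> y = 0" if "[0 = x] (mod k)" "[0 = y] (mod k)" "\<bar>x\<bar> < k \<and> \<bar>y\<bar> < k" for k
    proof -
      have "k dvd x" "k dvd y"
        using that by (simp_all add: cong_0_iff cong_sym_eq[of 0])
      then show ?thesis using dvd_imp_le_int[of x k] dvd_imp_le_int[of y k] that(3) by linarith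
    qed
    have Em: "a mod m = b mod m \<and> b mod m = c mod m" if "(x, y) \<in> E"
      using avoids_modD[OF \<pi> inm inm inm that cm] .
    have Fn: "a mod n = b mod n \<and> b mod n = c mod n" if "(x, y) \<in> F"
      using avoids_modD[OF \<rho> inn inn inn that cn] .
    have "(x, y) \<in> E \<and> (x, y) \<in> F"
    proof (cases "(x, y) \<in> E")
      case True
      with Em zero[of m] E[OF True] cm 0 show ?thesis by simp
    next
      case False
      then have "(x, y) \<in> F" using \<open>(x, y) \<in> E \<union> F\<close> by blast
      with Fn zero[of n] F cn 0 show ?thesis by simp
    qed
    with Em Fn show ?thesis using eqI abc by metis
  qed
  ultimately show ?thesis by (blast intro: avoids_modI)
qed

lemma bij_betw_mult_mod:
  assumes "coprime u n" "n > 0"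
  shows "bij_betw (\<lambda>x. u * x mod n) {0..<n} {0..<n :: int}"
proof (rule bij_betw_if_inj_on_interval)
  show "inj_on (\<lambda>x. u * x mod n) {0..<n}"
  proof (rule inj_onI)
    fix x y assume xy: "x \<in> {0..<n}" "y \<in> {0..<n}" "u * x mod n = u * y mod n"
    then have "[x = y] (mod n)"
      using assms by (simp add: cong_mult_lcancel cong_def[symmetric])
    then show "x = y" using xy cong_eq_int by blast
  qed
qed (use assms in simp)

text \<open>Multiplying arguments by \<open>u\<close> and values by \<open>v\<close> multiplies the
  respective second differences. The condition on \<open>y'\<close> says that it is \<open>y\<close>
  divided by \<open>v\<close>, without naming an inverse.\<close>

lemma avoids_mod_scale:
  assumes \<pi>: "avoids_mod n E \<pi>" and "coprime u n" "coprime v n" "n > 0"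
    and F: "\<And>x y. (x, y) \<in> F \<Longrightarrow>
              \<exists>(x', y')\<in>E. [u * x = x'] (mod n) \<and> (\<forall>z. [v * z = y] (mod n) \<longrightarrow> [z = y'] (mod n))"
  shows "avoids_mod n F (\<lambda>x. v * \<pi> (u * x mod n) mod n)"
proof (rule avoids_modI)
  show "bij_betw (\<lambda>x. v * \<pi> (u * x mod n) mod n) {0..<n} {0..<n}"
    using bij_betw_trans[OF bij_betw_trans[OF bij_betw_mult_mod[of u n] avoids_mod_bij[OF \<pi>]]
        bij_betw_mult_mod[of v n]] assms
    by (simp add: comp_def)
next
  fix a b c x y
  assume abc: "a \<in> {0..<n}" "b \<in> {0..<n}" "c \<in> {0..<n}" and "(x, y) \<in> F"
    and 1: "[a + c - 2 * b = x] (mod n)"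
    and 2: "[v * \<pi> (u * a mod n) mod n + v * \<pi> (u * c mod n) mod n
             - 2 * (v * \<pi> (u * b mod n) mod n) = y] (mod n)"
  obtain x' y' where xy': "(x', y') \<in> E" "[u * x = x'] (mod n)"
    and y': "\<And>z. [v * z = y] (mod n) \<Longrightarrow> [z = y'] (mod n)"
    using F[OF \<open>(x, y) \<in> F\<close>] by blast
  have "[u * a mod n + u * c mod n - 2 * (u * b mod n) = u * (a + c - 2 * b)] (mod n)"
    using cong_mod_mod_mod[of "u * a" n "u * c" "u * b"] by (simp add: algebra_simps)
  also have "[u * (a + c - 2 * b) = u * x] (mod n)"
    by (intro cong_mult 1) simp
  finally have A: "[u * a mod n + u * c mod n - 2 * (u * b mod n) = x'] (mod n)"
    using xy'(2) cong_trans by blast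
  have "[v * (\<pi> (u * a mod n) + \<pi> (u * c mod n) - 2 * \<pi> (u * b mod n)) = y] (mod n)"
    using cong_trans[OF cong_sym[OF cong_mod_mod_mod] 2] by (simp add: algebra_simps)
  from y'[OF this] have "u * a mod n = u * b mod n \<and> u * b mod n = u * c mod n"
    using avoids_modD[OF \<pi> _ _ _ xy'(1) A] \<open>n > 0\<close> by simp
  then show "a = b \<and> b = c"
    using bij_betw_imp_inj_on[OF bij_betw_mult_mod[OF \<open>coprime u n\<close> \<open>n > 0\<close>]] abc
    by (meson inj_onD)
qed

text \<open>If \<open>\<pi>\<close> induces the identity modulo a divisor \<open>d\<close> of \<open>n\<close>, then the two second differences of a
  triple agree modulo \<open>d\<close>, which rules out all pairs \<open>(x, y)\<close> with \<open>x \<noteq> y\<close> modulo \<open>d\<close> at once.\<close>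

lemma avoids_mod_if_cong_id:
  assumes \<pi>: "avoids_mod n E \<pi>" and "d dvd n"
    and id: "\<And>x. x \<in> {0..<n} \<Longrightarrow> [\<pi> x = x] (mod d)"
  shows "avoids_mod n (E \<union> {(x, y). \<not> [x = y] (mod d)}) \<pi>"
proof (rule avoids_modI)
  fix a b c x y
  assume abc: "a \<in> {0..<n}" "b \<in> {0..<n}" "c \<in> {0..<n}"
    and xy: "(x, y) \<in> E \<union> {(x, y). \<not> [x = y] (mod d)}"
    and 1: "[a + c - 2 * b = x] (mod n)" and 2: "[\<pi> a + \<pi> c - 2 * \<pi> b = y] (mod n)"
  have "[\<pi> a + \<pi> c - 2 * \<pi> b = a + c - 2 * b] (mod d)"
    by (intro cong_diff cong_add cong_mult id abc cong_refl)
  then have "[x = y] (mod d)"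
    using cong_dvd_modulus[OF 1 \<open>d dvd n\<close>] cong_dvd_modulus[OF 2 \<open>d dvd n\<close>]
    by (metis cong_sym cong_trans)
  with xy show "a = b \<and> b = c" using avoids_modD[OF \<pi> abc _ 1 2] by blast
qed (rule avoids_mod_bij[OF \<pi>])

section \<open>Permutations of small cyclic groups\<close>

text \<open>An executable test: \<open>a\<close>, \<open>b\<close> and \<open>x\<close> determine
  \<open>c\<close>, so only quadratically many triples are checked for each pair.\<close>

definition table_avoids :: "(int \<times> int) list \<Rightarrow> int list \<Rightarrow> bool" where
  "table_avoids E xs \<longleftrightarrow> (let n = int (length xs) in
     distinct xs \<and> list_all (\<lambda>x. 0 \<le> x \<and> x < n) xs \<and>
     list_all (\<lambda>a. list_all (\<lambda>b. list_all (\<lambda>(x, y).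
       let c = (2 * b - a + x) mod n in
       a = b \<and> b = c \<or> (xs ! nat a + xs ! nat c - 2 * xs ! nat b - y) mod n \<noteq> 0) E)
       [0..n - 1]) [0..n - 1])"

lemma avoids_mod_if_table_avoids:
  assumes "table_avoids E xs"
  shows "avoids_mod (int (length xs)) (set E) (\<lambda>i. xs ! nat i)"
proof -
  define n where "n = int (length xs)"
  have xs: "distinct xs" "\<And>x. x \<in> set xs \<Longrightarrow> x \<in> {0..<n}"
    using assms by (auto simp: table_avoids_def n_def Let_def list_all_iff)
  have tab: "a = b \<and> b = (2 * b - a + x) mod n"
    if "a \<in> {0..<n}" "b \<in> {0..<n}" "(x, y) \<in> set E"
      "(xs ! nat a + xs ! nat ((2 * b - a + x) mod n) - 2 * xs ! nat b - y) mod n = 0" for a b x y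
    using assms that by (fastforce simp: table_avoids_def n_def Let_def list_all_iff)
  show ?thesis
    unfolding n_def[symmetric]
  proof (rule avoids_modI)
    show "bij_betw (\<lambda>i. xs ! nat i) {0..<n} {0..<n}"
    proof (rule bij_betw_if_inj_on_interval)
      show "xs ! nat x \<in> {0..<n}" if "x \<in> {0..<n}" for x
        using that by (intro xs(2) nth_mem) (auto simp: n_def)
      show "inj_on (\<lambda>i. xs ! nat i) {0..<n}"
        using xs(1) by (auto simp: inj_on_def n_def nth_eq_iff_index_eq)
    qed
  next
    fix a b c x y
    assume abc: "a \<in> {0..<n}" "b \<in> {0..<n}" "c \<in> {0..<n}" "(x, y) \<in> set E"
      and 1: "[a + c - 2 * b = x] (mod n)"
      and 2: "[xs ! nat a + xs ! nat c - 2 * xs ! nat b = y] (mod n)"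
    have "[c = 2 * b - a + x] (mod n)"
      using 1 by (simp add: cong_iff_dvd_diff algebra_simps)
    then have c: "c = (2 * b - a + x) mod n"
      using abc by (simp add: cong_def)
    then show "a = b \<and> b = c"
      using tab[OF abc(1,2,4)] 2 by (metis cong_iff_dvd_diff mod_eq_0_iff_dvd)
  qed
qed

text \<open>The tables were found with a SAT solver.\<close>

definition table20 :: "int list" where
  "table20 = [0,1,18,13,14,9,8,19,16,15,6,7,12,11,2,5,10,3,4,17]"
definition table27 :: "int list" where
  "table27 = [0,4,17,12,13,11,15,16,14,9,10,23,24,22,26,18,25,20,21,19,5,3,7,8,6,1,2]"
definition table17 :: "int list" where
  "table17 = [0,4,2,13,10,3,16,11,15,14,7,5,9,12,6,1,8]"
definition table19 :: "int list" where
  "table19 = [0,3,7,18,4,6,11,8,13,16,1,14,10,17,2,9,12,5,15]"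

lemma table20: "table_avoids [(0, 0)] table20" "list_all (\<lambda>i. (table20 ! nat i - i) mod 2 = 0) [0..19]"
  by code_simp+

lemma table27: "table_avoids [(0, 0)] table27" "list_all (\<lambda>i. (table27 ! nat i - i) mod 3 = 0) [0..26]"
  by code_simp+

lemma table17: "table_avoids [(0, 0), (1, 1), (-1, -1)] table17"
  by code_simp

lemma table19: "table_avoids [(0, 0), (1, 1), (-1, -1)] table19"
  by code_simp

lemma coprime_table_lengths:
  "coprime (2 :: int) 19" "coprime (10 :: int) 19" "coprime (20 :: int) 27" "coprime (17 :: int) 19"
  "coprime (540 :: int) 323"
  by (simp_all add: coprime_iff_gcd_eq_1 gcd_non_0_int)

text \<open>Preserving residues modulo 2 on \<open>\<int>\<close>/20 and modulo 3 on \<open>\<int>\<close>/27 excludes all pairs in the box except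
  \<open>(0, 0)\<close>, \<open>\<plusminus>(1, 1)\<close> and \<open>\<plusminus>(2, 2)\<close>, which are left to the factors of order 17 and 19.\<close>

lemma avoids_mod_base: "\<exists>\<pi>. avoids_mod 174420 (box 2 2) \<pi>"
proof -
  have A: "avoids_mod 20 ({(0, 0)} \<union> {(x, y). \<not> [x = y] (mod 2)}) (\<lambda>i. table20 ! nat i)"
  proof (rule avoids_mod_if_cong_id)
    show "avoids_mod 20 {(0, 0)} (\<lambda>i. table20 ! nat i)"
      using avoids_mod_if_table_avoids[OF table20(1)] by (simp add: table20_def)
    show "[table20 ! nat x = x] (mod 2)" if "x \<in> {0..<20}" for x
      using table20(2) that by (simp add: list_all_iff cong_iff_dvd_diff mod_eq_0_iff_dvd)
  qed simp
  have B: "avoids_mod 27 ({(0, 0)} \<union> {(x, y). \<not> [x = y] (mod 3)}) (\<lambda>i. table27 ! nat i)"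
  proof (rule avoids_mod_if_cong_id)
    show "avoids_mod 27 {(0, 0)} (\<lambda>i. table27 ! nat i)"
      using avoids_mod_if_table_avoids[OF table27(1)] by (simp add: table27_def)
    show "[table27 ! nat x = x] (mod 3)" if "x \<in> {0..<27}" for x
      using table27(2) that by (simp add: list_all_iff cong_iff_dvd_diff mod_eq_0_iff_dvd)
  qed simp
  have C: "avoids_mod 17 {(0, 0), (1, 1), (-1, -1)} (\<lambda>i. table17 ! nat i)"
    using avoids_mod_if_table_avoids[OF table17] by (simp add: table17_def)
  have "avoids_mod 19 {(0, 0), (1, 1), (-1, -1)} (\<lambda>i. table19 ! nat i)"
    using avoids_mod_if_table_avoids[OF table19] by (simp add: table19_def)
  \<comment> \<open>Since 10 is the inverse of 2 modulo 19, scaling by 10 inside and by 2 outside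
    moves the excluded pairs \<open>(1, 1)\<close> and \<open>(-1, -1)\<close> to
    \<open>(2, 2)\<close> and \<open>(-2, -2)\<close>.\<close>
  then have D: "avoids_mod 19 {(0, 0), (2, 2), (-2, -2)} (\<lambda>x. 2 * (table19 ! nat (10 * x mod 19)) mod 19)"
  proof (rule avoids_mod_scale)
    have "[z = w] (mod 19)" if "[2 * z = 2 * w] (mod 19)" for z w :: int
      using that cong_mult_lcancel[of 2 19 z w] coprime_table_lengths by simp
    then have cancel: "\<forall>z. [2 * z = 2 * w] (mod 19) \<longrightarrow> [z = w] (mod 19)" for w :: int
      by blast
    have inv2: "[10 * 2 = 1] (mod (19 :: int))" "[10 * (- 2) = - 1] (mod (19 :: int))"
      by (simp_all add: cong_def)
    fix x y :: int assume "(x, y) \<in> {(0, 0), (2, 2), (-2, -2)}"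
    then consider "x = 0" "y = 0" | "x = 2" "y = 2" | "x = -2" "y = -2" by blast
    then show "\<exists>(x', y')\<in>{(0, 0), (1, 1), (-1, -1)}.
        [10 * x = x'] (mod 19) \<and> (\<forall>z. [2 * z = y] (mod 19) \<longrightarrow> [z = y'] (mod 19))"
    proof cases
      case 1
      then show ?thesis using cancel[of 0] by (intro bexI[of _ "(0, 0)"]) simp_all
    next
      case 2
      then show ?thesis using cancel[of 1] inv2 by (intro bexI[of _ "(1, 1)"]) simp_all
    next
      case 3
      then show ?thesis using cancel[of "- 1"] inv2 by (intro bexI[of _ "(- 1, - 1)"]) simp_all
    qed
  qed (simp_all add: coprime_table_lengths)
  \<comment> \<open>Intersecting with the box keeps all entries below the moduli, as the product
    lemma demands.\<close>
  define E2 E3 E1 :: "(int \<times> int) set"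
    where "E2 = box 2 2 \<inter> ({(0, 0)} \<union> {(x, y). \<not> [x = y] (mod 2)})"
      and "E3 = box 2 2 \<inter> ({(0, 0)} \<union> {(x, y). \<not> [x = y] (mod 3)})"
      and "E1 = {(0, 0), (1, 1), (-1, -1)} \<union> {(0, 0), (2, 2), (-2, -2)}"
  have sub: "E2 \<subseteq> box 2 2" "E3 \<subseteq> box 2 2" "E1 \<subseteq> box 2 2"
    by (auto simp: E1_def E2_def E3_def)
  have le2: "\<bar>x\<bar> < m \<and> \<bar>y\<bar> < m" if "(x, y) \<in> box 2 2" "2 < m" for x y m :: int
    using that by auto
  have zero: "(0, 0) \<in> E1" "(0, 0) \<in> E2" "(0, 0) \<in> E3"
    by (auto simp: E1_def E2_def E3_def)
  have A': "avoids_mod 20 E2 (\<lambda>i. table20 ! nat i)" and B': "avoids_mod 27 E3 (\<lambda>i. table27 ! nat i)"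
    unfolding E2_def E3_def
    by (rule avoids_mod_mono[OF A Int_lower2], rule avoids_mod_mono[OF B Int_lower2])
  have "\<exists>\<rho>. avoids_mod (20 * 27) (E2 \<union> E3) \<rho>"
  proof (rule avoids_mod_product[OF coprime_table_lengths(3) _ _ A' B' zero(2,3)])
    show "\<bar>x\<bar> < 20 \<and> \<bar>y\<bar> < 20" if "(x, y) \<in> E2" for x y
      using le2[OF subsetD[OF sub(1) that]] by simp
    show "\<bar>x\<bar> < 27 \<and> \<bar>y\<bar> < 27" if "(x, y) \<in> E3" for x y
      using le2[OF subsetD[OF sub(2) that]] by simp
  qed simp_all
  then obtain \<rho> where \<rho>: "avoids_mod 540 (E2 \<union> E3) \<rho>" by auto
  have "\<exists>\<sigma>. avoids_mod (17 * 19) E1 \<sigma>"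
    unfolding E1_def by (rule avoids_mod_product[OF coprime_table_lengths(4) _ _ C D]) auto
  then obtain \<sigma> where \<sigma>: "avoids_mod 323 E1 \<sigma>" by auto
  have "\<exists>\<pi>. avoids_mod (540 * 323) (E2 \<union> E3 \<union> E1) \<pi>"
  proof (rule avoids_mod_product[OF coprime_table_lengths(5) _ _ \<rho> \<sigma> _ zero(1)])
    show "\<bar>x\<bar> < 540 \<and> \<bar>y\<bar> < 540" if "(x, y) \<in> E2 \<union> E3" for x y
      using le2[OF subsetD[OF Un_least[OF sub(1,2)] that]] by simp
    show "\<bar>x\<bar> < 323 \<and> \<bar>y\<bar> < 323" if "(x, y) \<in> E1" for x y
      using le2[OF subsetD[OF sub(3) that]] by simp
  qed (simp_all add: zero)
  then obtain \<pi> where "avoids_mod 174420 (E2 \<union> E3 \<union> E1) \<pi>" by auto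
  moreover have "box 2 2 \<subseteq> E2 \<union> E3 \<union> E1"
  proof (rule subrelI)
    fix x y :: int assume xy: "(x, y) \<in> box 2 2"
    show "(x, y) \<in> E2 \<union> E3 \<union> E1"
    proof (cases "[x = y] (mod 2) \<and> [x = y] (mod 3)")
      case True
      then have "2 dvd x - y" "3 dvd x - y" by (simp_all add: cong_iff_dvd_diff)
      moreover have "\<bar>x - y\<bar> \<le> 4" using xy by auto
      \<comment> \<open>6 divides \<open>x - y\<close>, whose absolute value is at most 4.\<close>
      ultimately have "x = y" by presburger
      moreover have "x = -2 \<or> x = -1 \<or> x = 0 \<or> x = 1 \<or> x = 2" using xy by auto
      ultimately show ?thesis unfolding E1_def by blast
    next
      case False
      then show ?thesis using xy unfolding E2_def E3_def by blast
    qed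
  qed
  ultimately have "avoids_mod 174420 (box 2 2) \<pi>" by (rule avoids_mod_mono)
  then show ?thesis by blast
qed

section \<open>Permutations of integer intervals\<close>

lemma avoids_int_inv:
  assumes \<pi>: "avoids_int n s t \<pi>"
  shows "avoids_int n t s (inv_into {0..<n} \<pi>)"
proof (rule avoids_intI)
  note bij = avoids_int_bij[OF \<pi>]
  show *: "bij_betw (inv_into {0..<n} \<pi>) {0..<n} {0..<n}"
    using bij by (rule bij_betw_inv_into)
  fix a b c
  assume abc: "a \<in> {0..<n}" "b \<in> {0..<n}" "c \<in> {0..<n}"
  then have in_dom: "inv_into {0..<n} \<pi> a \<in> {0..<n}" "inv_into {0..<n} \<pi> b \<in> {0..<n}"
    "inv_into {0..<n} \<pi> c \<in> {0..<n}"
    using bij_betwE[OF *] by blast+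
  have inv: "\<pi> (inv_into {0..<n} \<pi> x) = x" if "x \<in> {0..<n}" for x
    using bij that by (rule bij_betw_inv_into_right)
  assume "\<bar>a + c - 2 * b\<bar> \<le> t"
    "\<bar>inv_into {0..<n} \<pi> a + inv_into {0..<n} \<pi> c - 2 * inv_into {0..<n} \<pi> b\<bar> \<le> s"
  then show "a = b \<and> b = c"
    using avoids_intD[OF \<pi> in_dom] inv abc by metis
qed

text \<open>Even numbers are sent to the first half of the interval and odd numbers to the second half. The
  ends \<open>a\<close> and \<open>c\<close> of a progression have the same parity; if the midpoint has the other one, then its
  image lies on one side of the images of both ends.\<close>

lemma avoids_int_0_0: "\<exists>\<pi>. avoids_int n 0 0 \<pi>"
proof (induction "nat n" arbitrary: n rule: less_induct)
  case less
  show ?case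
  \<comment> \<open>Negative \<open>n\<close> falls under the first case as well: the interval is
    empty.\<close>
  proof (cases "n \<le> 1")
    case True
    then have "avoids_int n 0 0 id"
      by (auto intro!: avoids_intI)
    then show ?thesis by blast
  next
    case False
    \<comment> \<open>\<open>h\<close> counts the even and \<open>n - h\<close> the odd numbers in
      the interval.\<close>
    define h where "h = (n + 1) div 2"
    have h: "2 * h \<ge> n" "2 * h \<le> n + 1" "h < n" "n - h < n" "h > 0"
      using False unfolding h_def by linarith+
    obtain \<sigma> where \<sigma>: "avoids_int h 0 0 \<sigma>" using less[of h] h by auto
    obtain \<rho> where \<rho>: "avoids_int (n - h) 0 0 \<rho>" using less[of "n - h"] h by auto
    note bij\<sigma> = avoids_int_bij[OF \<sigma>] and bij\<rho> = avoids_int_bij[OF \<rho>]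
    define \<pi> where "\<pi> x = (if even x then \<sigma> (x div 2) else h + \<rho> (x div 2))" for x
    have even_dom: "x div 2 \<in> {0..<h}" if "x \<in> {0..<n}" "even x" for x
      using that h by auto
    have odd_dom: "x div 2 \<in> {0..<n - h}" if "x \<in> {0..<n}" "odd x" for x
      using that h by (auto elim!: oddE)
    have even: "\<pi> x = \<sigma> (x div 2)" "0 \<le> \<pi> x" "\<pi> x < h" if "x \<in> {0..<n}" "even x" for x
      using bij_betwE[OF bij\<sigma>] even_dom[OF that] that by (auto simp: \<pi>_def)
    have odd: "\<pi> x = h + \<rho> (x div 2)" "h \<le> \<pi> x" "\<pi> x < n" if "x \<in> {0..<n}" "odd x" for x
      using bij_betwE[OF bij\<rho>] odd_dom[OF that] that by (fastforce simp: \<pi>_def)+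
    have bij: "bij_betw \<pi> {0..<n} {0..<n}"
    proof (rule bij_betw_if_inj_on_interval)
      show "\<pi> x \<in> {0..<n}" if "x \<in> {0..<n}" for x
      proof (cases "even x")
        case True
        then show ?thesis using even(2,3)[OF that True] h by simp
      next
        case False
        then show ?thesis using odd(2,3)[OF that False] h by simp
      qed
      show "inj_on \<pi> {0..<n}"
      proof (rule inj_onI)
        fix x y assume xy: "x \<in> {0..<n}" "y \<in> {0..<n}" "\<pi> x = \<pi> y"
        then have par: "even x \<longleftrightarrow> even y"
          using even(3) odd(2) by (metis leD)
        have "x div 2 = y div 2"
        proof (cases "even x")
          case True
          then show ?thesis
            using xy par even(1) even_dom bij_betw_imp_inj_on[OF bij\<sigma>] by (metis inj_onD)
        next
          case False
          then have "\<rho> (x div 2) = \<rho> (y div 2)" using xy par odd(1) by simp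
          then show ?thesis
            using False xy par odd_dom bij_betw_imp_inj_on[OF bij\<rho>] by (metis inj_onD)
        qed
        with par show "x = y" by (metis even_two_times_div_two odd_two_times_div_two_succ)
      qed
    qed
    have AP: "a = b \<and> b = c"
      if abc: "a \<in> {0..<n}" "b \<in> {0..<n}" "c \<in> {0..<n}"
        and 1: "a + c = 2 * b" and 2: "\<pi> a + \<pi> c = 2 * \<pi> b" for a b c
    proof -
      have par: "even a \<longleftrightarrow> even c" using 1 by (metis dvd_triv_left even_add)
      have same: "even a \<longleftrightarrow> even b"
        using par 2 even(3)[OF abc(1)] even(3)[OF abc(2)] even(3)[OF abc(3)]
          odd(2)[OF abc(1)] odd(2)[OF abc(2)] odd(2)[OF abc(3)] by linarith
      \<comment> \<open>With equal parities, \<open>div 2\<close> drops the same remainder from all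
        three terms.\<close>
      have div: "a div 2 + c div 2 = 2 * (b div 2)"
        using par same 1 by (cases "even a") (auto elim!: evenE oddE)
      have "a div 2 = b div 2 \<and> b div 2 = c div 2"
      proof (cases "even a")
        case True
        then have ev: "even a" "even b" "even c" using par same by simp_all
        have "\<sigma> (a div 2) + \<sigma> (c div 2) = 2 * \<sigma> (b div 2)"
          using 2 even(1)[OF abc(1) ev(1)] even(1)[OF abc(2) ev(2)] even(1)[OF abc(3) ev(3)] by linarith
        then show ?thesis
          by (intro avoids_intD[OF \<sigma> even_dom[OF abc(1) ev(1)] even_dom[OF abc(2) ev(2)]
                even_dom[OF abc(3) ev(3)]]) (simp_all add: div)
      next
        case False
        then have od: "odd a" "odd b" "odd c" using par same by simp_all
        have "\<rho> (a div 2) + \<rho> (c div 2) = 2 * \<rho> (b div 2)"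
          using 2 odd(1)[OF abc(1) od(1)] odd(1)[OF abc(2) od(2)] odd(1)[OF abc(3) od(3)] by linarith
        then show ?thesis
          by (intro avoids_intD[OF \<rho> odd_dom[OF abc(1) od(1)] odd_dom[OF abc(2) od(2)]
                odd_dom[OF abc(3) od(3)]]) (simp_all add: div)
      qed
      with par same show ?thesis by (metis even_two_times_div_two odd_two_times_div_two_succ)
    qed
    have "avoids_int n 0 0 \<pi>"
      by (rule avoids_intI[OF bij], rule AP) simp_all
    then show ?thesis by blast
  qed
qed

section \<open>Permuting blocks of nearly equal length\<close>

text \<open>Block \<open>i\<close> starts at the sum of the earlier lengths. The bounds place this
  start within \<open>i\<close> of \<open>q * i\<close>, which is how block indices are later
  recovered from positions up to a small error.\<close>

lemma consecutive_blocks: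
  fixes c :: "int \<Rightarrow> int"
  assumes "\<And>i. i \<in> {0..<int k} \<Longrightarrow> c i \<in> {q, q + 1}" and "q \<ge> 0"
  shows "bij_betw (\<lambda>(i, y). sum c {0..<i} + y) (SIGMA i:{0..<int k}. {0..<c i}) {0..<sum c {0..<int k}}"
    and "\<And>i. i \<in> {0..int k} \<Longrightarrow> q * i \<le> sum c {0..<i} \<and> sum c {0..<i} \<le> (q + 1) * i"
proof -
  have "bij_betw (\<lambda>(i, y). sum c {0..<i} + y) (SIGMA i:{0..<int k}. {0..<c i}) {0..<sum c {0..<int k}}
    \<and> (\<forall>i\<in>{0..int k}. q * i \<le> sum c {0..<i} \<and> sum c {0..<i} \<le> (q + 1) * i)"
    (is "bij_betw ?f _ _ \<and> _")
    using assms(1)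
  proof (induction k)
    case 0
    then show ?case by (simp add: bij_betw_def)
  next
    case (Suc k)
    define m where "m = sum c {0..<int k}"
    have IH: "bij_betw ?f (SIGMA i:{0..<int k}. {0..<c i}) {0..<m}"
      "\<And>i. i \<in> {0..int k} \<Longrightarrow> q * i \<le> sum c {0..<i} \<and> sum c {0..<i} \<le> (q + 1) * i"
      using Suc by (simp_all add: m_def)
    have ck: "c (int k) \<in> {q, q + 1}" using Suc.prems by simp
    have ivl: "{0..<int (Suc k)} = insert (int k) {0..<int k}" by auto
    have sum: "sum c {0..<int (Suc k)} = m + c (int k)"
      by (subst ivl) (simp add: m_def)
    have m: "q * int k \<le> m" "m \<le> (q + 1) * int k"
      using IH(2)[of "int k"] by (simp_all add: m_def)
    then have "m \<ge> 0" using \<open>q \<ge> 0\<close> by (meson mult_nonneg_nonneg of_nat_0_le_iff order_trans)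
    have "bij_betw ?f ({int k} \<times> {0..<c (int k)}) {m..<m + c (int k)}"
      by (rule bij_betwI[where g = "\<lambda>z. (int k, z - m)"]) (auto simp: m_def)
    from bij_betw_combine[OF IH(1) this]
    have "bij_betw ?f ((SIGMA i:{0..<int k}. {0..<c i}) \<union> {int k} \<times> {0..<c (int k)})
      ({0..<m} \<union> {m..<m + c (int k)})" by auto
    moreover have "(SIGMA i:{0..<int k}. {0..<c i}) \<union> {int k} \<times> {0..<c (int k)}
      = (SIGMA i:{0..<int (Suc k)}. {0..<c i})"
      unfolding ivl by auto
    moreover have "{0..<m} \<union> {m..<m + c (int k)} = {0..<sum c {0..<int (Suc k)}}"
      unfolding sum using \<open>m \<ge> 0\<close> ck \<open>q \<ge> 0\<close> by auto
    moreover have "q * i \<le> sum c {0..<i} \<and> sum c {0..<i} \<le> (q + 1) * i" if "i \<in> {0..int (Suc k)}" for i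
    proof (cases "i = int (Suc k)")
      case True
      with sum m ck show ?thesis by (auto simp: algebra_simps)
    next
      case False
      with that IH(2) show ?thesis by simp
    qed
    ultimately show ?case by simp
  qed
  then show "bij_betw ?f (SIGMA i:{0..<int k}. {0..<c i}) {0..<sum c {0..<int k}}"
    "\<And>i. i \<in> {0..int k} \<Longrightarrow> q * i \<le> sum c {0..<i} \<and> sum c {0..<i} \<le> (q + 1) * i"
    by blast+
qed

text \<open>The domain is split into pieces \<open>i\<close> of length \<open>c i\<close> by an arbitrary bijection \<open>\<alpha>\<close>, whereas the
  image of piece \<open>i\<close> is the \<open>\<tau> i\<close>-th block of consecutive integers, starting at \<open>S (\<tau> i)\<close>.\<close>

lemma block_permutation:
  fixes \<tau> c :: "int \<Rightarrow> int"
  assumes \<tau>: "bij_betw \<tau> {0..<k} {0..<k}"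
    and c: "\<And>i. i \<in> {0..<k} \<Longrightarrow> c i \<in> {q, q + 1}"
    and \<alpha>: "bij_betw \<alpha> (SIGMA i:{0..<k}. {0..<c i}) {0..<n}"
    and \<sigma>: "\<And>i. i \<in> {0..<k} \<Longrightarrow> bij_betw (\<sigma> i) {0..<c i} {0..<c i}"
    and "k \<ge> 0" "q \<ge> 0" "n \<ge> 0"
  obtains \<pi> S where "bij_betw \<pi> {0..<n} {0..<n}"
    "\<And>i y. i \<in> {0..<k} \<Longrightarrow> y \<in> {0..<c i} \<Longrightarrow> \<pi> (\<alpha> (i, y)) = S (\<tau> i) + \<sigma> i y"
    "\<And>j. j \<in> {0..<k} \<Longrightarrow> q * j \<le> S j \<and> S j \<le> (q + 1) * j"
proof -
  let ?X = "SIGMA i:{0..<k}. {0..<c i}"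
  \<comment> \<open>Block \<open>j\<close> of the image inherits the length of the piece that
    \<open>\<tau>\<close> sends to it.\<close>
  define d where "d j = c (inv_into {0..<k} \<tau> j)" for j
  have \<tau>in: "\<tau> i \<in> {0..<k}" if "i \<in> {0..<k}" for i
    using bij_betwE[OF \<tau>] that by blast
  have d\<tau>: "d (\<tau> i) = c i" if "i \<in> {0..<k}" for i
    using bij_betw_inv_into_left[OF \<tau> that] by (simp add: d_def)
  have d: "d j \<in> {q, q + 1}" if "j \<in> {0..<k}" for j
    unfolding d_def using c bij_betwE[OF bij_betw_inv_into[OF \<tau>]] that by blast
  define S where "S j = sum d {0..<j}" for j
  note blocks = consecutive_blocks[of "nat k" d q, OF _ \<open>q \<ge> 0\<close>]
  \<comment> \<open>Counting the domain of \<open>\<alpha>\<close> shows that the image blocks fill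
    exactly \<open>{0..<n}\<close>.\<close>
  have "sum d {0..<k} = sum c {0..<k}"
    using sum.reindex_bij_betw[OF \<tau>, of d] d\<tau> by simp
  also have "\<dots> = (\<Sum>i\<in>{0..<k}. int (card {0..<c i}))"
    using c \<open>q \<ge> 0\<close> by (intro sum.cong) force+
  also have "\<dots> = int (card ?X)"
    by (subst card_SigmaI) auto
  also have "card ?X = card {0..<n}"
    using \<alpha> by (rule bij_betw_same_card)
  finally have n: "sum d {0..<k} = n" using \<open>n \<ge> 0\<close> by simp
  have \<beta>: "bij_betw (\<lambda>(j, y). S j + y) (SIGMA j:{0..<k}. {0..<d j}) {0..<n}"
    using blocks(1) d n \<open>k \<ge> 0\<close> by (simp add: S_def)
  let ?f = "\<lambda>(i, y). (\<tau> i, \<sigma> i y)"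
  have "bij_betw ?f ?X (SIGMA j:{0..<k}. {0..<d j})"
  proof (rule bij_betw_imageI)
    show "inj_on ?f ?X"
    proof (rule inj_onI)
      fix p p' assume p: "p \<in> ?X" "p' \<in> ?X" "?f p = ?f p'"
      obtain i y i' y' where p_eq: "p = (i, y)" "p' = (i', y')" by (metis surj_pair)
      have iy: "i \<in> {0..<k}" "i' \<in> {0..<k}" "y \<in> {0..<c i}" "y' \<in> {0..<c i'}"
        and eq: "\<tau> i = \<tau> i'" "\<sigma> i y = \<sigma> i' y'"
        using p unfolding p_eq by auto
      have "i = i'" using bij_betw_imp_inj_on[OF \<tau>] eq(1) iy(1,2) by (rule inj_onD)
      moreover from this have "y = y'"
        using bij_betw_imp_inj_on[OF \<sigma>[OF iy(1)]] eq(2) iy(3,4) by (metis inj_onD)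
      ultimately show "p = p'" by (simp add: p_eq)
    qed
    show "?f ` ?X = (SIGMA j:{0..<k}. {0..<d j})"
    proof (intro equalityI subsetI)
      fix p assume "p \<in> ?f ` ?X"
      then obtain i y where p: "p = (\<tau> i, \<sigma> i y)" and iy: "i \<in> {0..<k}" "y \<in> {0..<c i}" by auto
      then show "p \<in> (SIGMA j:{0..<k}. {0..<d j})"
        using \<tau>in d\<tau> bij_betwE[OF \<sigma>[OF iy(1)]] by auto
    next
      fix p assume "p \<in> (SIGMA j:{0..<k}. {0..<d j})"
      then obtain j z where p: "p = (j, z)" and j: "j \<in> {0..<k}" and z: "z \<in> {0..<d j}" by auto
      have "j \<in> \<tau> ` {0..<k}"
        using j unfolding bij_betw_imp_surj_on[OF \<tau>] .
      then obtain i where i: "i \<in> {0..<k}" "\<tau> i = j" by blast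
      have "z \<in> \<sigma> i ` {0..<c i}"
        using z i(2) d\<tau>[OF i(1)] unfolding bij_betw_imp_surj_on[OF \<sigma>[OF i(1)]] by simp
      then obtain y where "y \<in> {0..<c i}" "\<sigma> i y = z" by blast
      with i p show "p \<in> ?f ` ?X" by (intro image_eqI[of _ _ "(i, y)"]) auto
    qed
  qed
  note whole = bij_betw_trans[OF bij_betw_trans[OF bij_betw_inv_into[OF \<alpha>] this] \<beta>]
  show thesis
  proof (rule that[OF whole, of S])
    show "((\<lambda>(j, y). S j + y) \<circ> (?f \<circ> inv_into ?X \<alpha>)) (\<alpha> (i, y)) = S (\<tau> i) + \<sigma> i y"
      if "i \<in> {0..<k}" "y \<in> {0..<c i}" for i y
      using bij_betw_inv_into_left[OF \<alpha>, of "(i, y)"] that by simp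
    show "q * j \<le> S j \<and> S j \<le> (q + 1) * j" if "j \<in> {0..<k}" for j
      using blocks(2)[of j] d that \<open>k \<ge> 0\<close> by (simp add: S_def)
  qed
qed

text \<open>A position in block \<open>j\<close> is \<open>q * j\<close> plus an offset below
  \<open>q + k\<close>. The second difference of the positions is thus \<open>q * I + W\<close>,
  with \<open>I\<close> that of the indices; dividing the congruence by \<open>q\<close> gives
  \<open>I\<close> modulo \<open>k\<close> up to an error smaller than 3.\<close>

lemma block_second_difference:
  fixes q k \<rho> t :: int
  assumes i: "i\<^sub>1 \<in> {0..<k}" "i\<^sub>2 \<in> {0..<k}" "i\<^sub>3 \<in> {0..<k}"
    and S: "\<And>j. j \<in> {0..<k} \<Longrightarrow> q * j \<le> S j \<and> S j \<le> (q + 1) * j"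
    and y: "y\<^sub>1 \<in> {0..q}" "y\<^sub>2 \<in> {0..q}" "y\<^sub>3 \<in> {0..q}"
    and \<rho>: "0 \<le> \<rho>" "\<rho> < k" and t: "0 \<le> t" "t + 4 * k \<le> q"
    and cong: "[S i\<^sub>1 + y\<^sub>1 + (S i\<^sub>3 + y\<^sub>3) - 2 * (S i\<^sub>2 + y\<^sub>2) = \<eta>] (mod (k * q + \<rho>))" and "\<bar>\<eta>\<bar> \<le> t"
  shows "\<exists>d\<in>{-2..2}. [i\<^sub>1 + i\<^sub>3 - 2 * i\<^sub>2 = d] (mod k)"
proof -
  define w where "w j y = S j + y - q * j" for j y
  have w: "0 \<le> w j y" "w j y \<le> q + k - 1" if "j \<in> {0..<k}" "y \<in> {0..q}" for j y
    using S[OF that(1)] that by (auto simp: w_def algebra_simps)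
  define W where "W = w i\<^sub>1 y\<^sub>1 + w i\<^sub>3 y\<^sub>3 - 2 * w i\<^sub>2 y\<^sub>2"
  define I where "I = i\<^sub>1 + i\<^sub>3 - 2 * i\<^sub>2"
  have W: "\<bar>W\<bar> \<le> 2 * (q + k - 1)"
    using w[OF i(1) y(1)] w[OF i(2) y(2)] w[OF i(3) y(3)] by (auto simp: W_def)
  have I: "\<bar>I\<bar> \<le> 2 * (k - 1)" using i by (auto simp: I_def)
  have "S i\<^sub>1 + y\<^sub>1 + (S i\<^sub>3 + y\<^sub>3) - 2 * (S i\<^sub>2 + y\<^sub>2) = q * I + W"
    by (simp add: W_def I_def w_def algebra_simps)
  with cong obtain l where l: "q * I + W = \<eta> + l * (k * q + \<rho>)"
    by (metis cong_iff_lin cong_sym_eq mult.commute)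
  have k: "k \<ge> 1" "q \<ge> 4" using i t by auto
  \<comment> \<open>\<open>l\<close> counts the wraps around the modulus, each of which adds an
    error \<open>\<rho>\<close> to the multiple \<open>k * q\<close>. Three or more wraps would
    exceed the size of \<open>q * I + W - \<eta>\<close>.\<close>
  have "\<bar>l\<bar> \<le> 2"
  proof (rule ccontr)
    assume "\<not> \<bar>l\<bar> \<le> 2"
    then have "3 * (k * q) \<le> \<bar>l\<bar> * (k * q + \<rho>)"
      using k \<rho> by (intro mult_mono) auto
    also have "\<dots> = \<bar>q * I + W - \<eta>\<bar>"
      using l k \<rho> by (simp add: abs_mult)
    also have "\<dots> \<le> q * \<bar>I\<bar> + 2 * (q + k - 1) + t"
      using W \<open>\<bar>\<eta>\<bar> \<le> t\<close> k abs_mult[of q I] by linarith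
    also have "\<dots> \<le> q * (2 * (k - 1)) + 2 * (q + k - 1) + t"
      using I k by (simp add: mult_left_mono)
    also have "\<dots> < 2 * (k * q) + q"
      using t k by (simp add: algebra_simps)
    also have "\<dots> \<le> 3 * (k * q)"
      using k by (simp add: mult_left_mono[of 1 k q, simplified] mult.commute)
    finally show False by simp
  qed
  have "\<bar>l * \<rho>\<bar> \<le> 2 * (k - 1)"
    using \<open>\<bar>l\<bar> \<le> 2\<close> \<rho> mult_mono[of "\<bar>l\<bar>" 2 \<rho> "k - 1"] by (simp add: abs_mult)
  have "q * \<bar>I - k * l\<bar> = \<bar>\<eta> + l * \<rho> - W\<bar>"
  proof -
    have "q * (I - k * l) = \<eta> + l * \<rho> - W" using l by (simp add: algebra_simps)
    then show ?thesis using k abs_mult[of q "I - k * l"] by simp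
  qed
  also have "\<dots> \<le> \<bar>\<eta>\<bar> + \<bar>l * \<rho>\<bar> + \<bar>W\<bar>"
    using abs_triangle_ineq4[of "\<eta> + l * \<rho>" W] abs_triangle_ineq[of \<eta> "l * \<rho>"] by linarith
  \<comment> \<open>The bounds sum to \<open>2 * q + t + 4 * k - 4\<close>; this is the source of
    the assumption \<open>t + 4 * k \<le> q\<close>.\<close>
  also have "\<dots> < 3 * q"
  proof -
    have "u + v + w < 3 * q" if "u \<le> t" "v \<le> 2 * (k - 1)" "w \<le> 2 * (q + k - 1)" for u v w
      using that t k by presburger
    then show ?thesis using \<open>\<bar>\<eta>\<bar> \<le> t\<close> \<open>\<bar>l * \<rho>\<bar> \<le> 2 * (k - 1)\<close> W by blast
  qed
  finally have "\<bar>I - k * l\<bar> < 3" using k by (simp add: mult.commute)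
  then have "I - k * l \<in> {-2..2}" by auto
  moreover have "[I = I - k * l] (mod k)" by (simp add: cong_iff_dvd_diff)
  ultimately show ?thesis unfolding I_def by blast
qed

text \<open>Piece \<open>r\<close> of the domain is the residue class of \<open>r\<close> modulo \<open>k\<close>. A triple that is not contained
  in one class is excluded by \<open>\<tau>\<close>, and \<open>s < k\<close> forces a triple inside one class to be an exact
  progression.\<close>

lemma avoids_int_residue_classes:
  assumes \<tau>: "avoids_mod k (box s 2) \<tau>" and "0 \<le> s" "s < k" "0 \<le> t"
    and ex: "\<And>m. m \<ge> m0 \<Longrightarrow> \<exists>\<sigma>. avoids_int m 0 t \<sigma>"
  shows "\<exists>m1. \<forall>m\<ge>m1. \<exists>\<pi>. avoids_int m s t \<pi>"
proof (rule exI, intro allI impI)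
  \<comment> \<open>The threshold makes \<open>m div k\<close> at least \<open>m0\<close>, so that
    every class has a suitable permutation, and at least \<open>t + 4 * k\<close>, as
    \<open>block_second_difference\<close> requires.\<close>
  fix m assume m: "m \<ge> k * max m0 (t + 4 * k)"
  define q \<rho> where "q = m div k" and "\<rho> = m mod k"
  have k: "k > 0" using assms by simp
  have mq: "m = k * q + \<rho>" and \<rho>: "0 \<le> \<rho>" "\<rho> < k"
    using k by (simp_all add: q_def \<rho>_def)
  have "q \<ge> max m0 (t + 4 * k)"
    using zdiv_mono1[OF m k] k by (simp add: q_def)
  then have q: "q \<ge> m0" "q \<ge> t + 4 * k" "q \<ge> 0" using k \<open>0 \<le> t\<close> by auto
  \<comment> \<open>The size of the class of \<open>r\<close> in \<open>{0..<m}\<close>: the first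
    \<open>\<rho>\<close> classes have an extra element.\<close>
  define c where "c r = (if r < \<rho> then q + 1 else q)" for r
  have c: "c r \<in> {q, q + 1}" for r by (simp add: c_def)
  have c_iff: "y < c r \<longleftrightarrow> k * y + r < m" if "0 \<le> r" "r < k" for y r
  proof -
    have "y \<le> q - 1 \<Longrightarrow> k * y \<le> k * (q - 1)" "y \<ge> q + 1 \<Longrightarrow> k * y \<ge> k * (q + 1)"
      using k by (simp_all add: mult_left_mono)
    then show ?thesis
      using that \<rho> unfolding c_def mq by (cases y q rule: linorder_cases) (auto simp: algebra_simps)
  qed
  have \<alpha>: "bij_betw (\<lambda>(r, y). k * y + r) (SIGMA r:{0..<k}. {0..<c r}) {0..<m}"
  proof (rule bij_betwI[where g = "\<lambda>x. (x mod k, x div k)"])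
    show "(\<lambda>x. (x mod k, x div k)) \<in> {0..<m} \<rightarrow> (SIGMA r:{0..<k}. {0..<c r})"
      using k by (auto simp: c_iff pos_imp_zdiv_nonneg_iff)
    show "(\<lambda>(r, y). k * y + r) \<in> (SIGMA r:{0..<k}. {0..<c r}) \<rightarrow> {0..<m}"
      using k c_iff by auto
  qed (use k in auto)
  have "\<forall>r. \<exists>\<sigma>. avoids_int (c r) 0 t \<sigma>"
    using ex q c by (force simp: c_def)
  then obtain \<sigma> where \<sigma>: "\<And>r. avoids_int (c r) 0 t (\<sigma> r)" by metis
  have "m \<ge> 0" using mq k q \<rho> by simp
  obtain \<pi> S where \<pi>: "bij_betw \<pi> {0..<m} {0..<m}"
    and \<pi>_eq: "\<And>r y. r \<in> {0..<k} \<Longrightarrow> y \<in> {0..<c r} \<Longrightarrow> \<pi> (k * y + r) = S (\<tau> r) + \<sigma> r y"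
    and S: "\<And>j. j \<in> {0..<k} \<Longrightarrow> q * j \<le> S j \<and> S j \<le> (q + 1) * j"
    by (rule block_permutation[OF avoids_mod_bij[OF \<tau>] c \<alpha> avoids_int_bij[OF \<sigma>]])
      (use k \<open>m \<ge> 0\<close> q in auto)
  have AP: "a\<^sub>1 = a\<^sub>2 \<and> a\<^sub>2 = a\<^sub>3"
    if a: "a\<^sub>1 \<in> {0..<m}" "a\<^sub>2 \<in> {0..<m}" "a\<^sub>3 \<in> {0..<m}"
      and 1: "\<bar>a\<^sub>1 + a\<^sub>3 - 2 * a\<^sub>2\<bar> \<le> s" and 2: "\<bar>\<pi> a\<^sub>1 + \<pi> a\<^sub>3 - 2 * \<pi> a\<^sub>2\<bar> \<le> t"
    for a\<^sub>1 a\<^sub>2 a\<^sub>3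
  proof -
    have "\<exists>r\<in>{0..<k}. \<exists>y\<in>{0..<c r}. a = k * y + r" if "a \<in> {0..<m}" for a
      using that unfolding bij_betw_imp_surj_on[OF \<alpha>, symmetric] by auto
    with a obtain r\<^sub>1 r\<^sub>2 r\<^sub>3 y\<^sub>1 y\<^sub>2 y\<^sub>3 where
      r: "r\<^sub>1 \<in> {0..<k}" "r\<^sub>2 \<in> {0..<k}" "r\<^sub>3 \<in> {0..<k}" and
      y: "y\<^sub>1 \<in> {0..<c r\<^sub>1}" "y\<^sub>2 \<in> {0..<c r\<^sub>2}" "y\<^sub>3 \<in> {0..<c r\<^sub>3}" and
      a_eq: "a\<^sub>1 = k * y\<^sub>1 + r\<^sub>1" "a\<^sub>2 = k * y\<^sub>2 + r\<^sub>2" "a\<^sub>3 = k * y\<^sub>3 + r\<^sub>3" by metis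
    have \<tau>r: "\<tau> r\<^sub>1 \<in> {0..<k}" "\<tau> r\<^sub>2 \<in> {0..<k}" "\<tau> r\<^sub>3 \<in> {0..<k}"
      using bij_betwE[OF avoids_mod_bij[OF \<tau>]] r by blast+
    have \<sigma>y: "\<sigma> r y \<in> {0..q}" if "y \<in> {0..<c r}" for r y
      using bspec[OF bij_betwE[OF avoids_int_bij[OF \<sigma>[of r]]] that] c[of r] by auto
    have \<pi>a: "\<pi> a\<^sub>1 = S (\<tau> r\<^sub>1) + \<sigma> r\<^sub>1 y\<^sub>1" "\<pi> a\<^sub>2 = S (\<tau> r\<^sub>2) + \<sigma> r\<^sub>2 y\<^sub>2"
      "\<pi> a\<^sub>3 = S (\<tau> r\<^sub>3) + \<sigma> r\<^sub>3 y\<^sub>3"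
      using \<pi>_eq r y a_eq by simp_all
    \<comment> \<open>An integer is congruent to itself, so the modular estimate applies with the
      second difference itself as \<open>\<eta>\<close>.\<close>
    obtain d where d: "d \<in> {-2..2}" "[\<tau> r\<^sub>1 + \<tau> r\<^sub>3 - 2 * \<tau> r\<^sub>2 = d] (mod k)"
      using block_second_difference[OF \<tau>r S \<sigma>y[OF y(1)] \<sigma>y[OF y(2)] \<sigma>y[OF y(3)] \<rho>
          \<open>0 \<le> t\<close> q(2) cong_refl] 2[unfolded \<pi>a] by blast
    have "[r\<^sub>1 + r\<^sub>3 - 2 * r\<^sub>2 = a\<^sub>1 + a\<^sub>3 - 2 * a\<^sub>2] (mod k)"
    proof -
      have "r\<^sub>1 + r\<^sub>3 - 2 * r\<^sub>2 - (a\<^sub>1 + a\<^sub>3 - 2 * a\<^sub>2) = k * (2 * y\<^sub>2 - y\<^sub>1 - y\<^sub>3)"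
        by (simp add: a_eq algebra_simps)
      then show ?thesis by (simp add: cong_iff_dvd_diff)
    qed
    \<comment> \<open>Residues keep the second difference of the domain exactly, whence the
      tolerance \<open>s\<close>; only the image blocks cost an error of 2.\<close>
    moreover have "(a\<^sub>1 + a\<^sub>3 - 2 * a\<^sub>2, d) \<in> box s 2"
      using d(1) 1 by (simp add: abs_le_iff)
    ultimately have rr: "r\<^sub>1 = r\<^sub>2 \<and> r\<^sub>2 = r\<^sub>3"
      using avoids_modD[OF \<tau> r _ _ d(2)] by blast
    have "k * (y\<^sub>1 + y\<^sub>3 - 2 * y\<^sub>2) = a\<^sub>1 + a\<^sub>3 - 2 * a\<^sub>2"
      using rr by (simp add: a_eq algebra_simps)
    then have "k * \<bar>y\<^sub>1 + y\<^sub>3 - 2 * y\<^sub>2\<bar> \<le> s"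
      using 1 k abs_mult[of k "y\<^sub>1 + y\<^sub>3 - 2 * y\<^sub>2"] by simp
    then have "k * \<bar>y\<^sub>1 + y\<^sub>3 - 2 * y\<^sub>2\<bar> < k * 1" using \<open>s < k\<close> by linarith
    then have "\<bar>y\<^sub>1 + y\<^sub>3 - 2 * y\<^sub>2\<bar> \<le> 0"
      unfolding mult_less_cancel_left_pos[OF k] by linarith
    moreover have "\<bar>\<sigma> r\<^sub>1 y\<^sub>1 + \<sigma> r\<^sub>1 y\<^sub>3 - 2 * \<sigma> r\<^sub>1 y\<^sub>2\<bar> \<le> t"
      using 2 rr by (simp add: \<pi>a)
    moreover have "y\<^sub>1 \<in> {0..<c r\<^sub>1}" "y\<^sub>2 \<in> {0..<c r\<^sub>1}" "y\<^sub>3 \<in> {0..<c r\<^sub>1}"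
      using y rr by simp_all
    ultimately have "y\<^sub>1 = y\<^sub>2 \<and> y\<^sub>2 = y\<^sub>3"
      using avoids_intD[OF \<sigma>] by blast
    then show ?thesis using rr a_eq by simp
  qed
  have "avoids_int m s t \<pi>" by (rule avoids_intI[OF \<pi>], rule AP)
  then show "\<exists>\<pi>. avoids_int m s t \<pi>" by blast
qed

text \<open>Here the pieces of the domain are blocks of consecutive integers as well, so that a triple is
  excluded by \<open>\<tau>\<close> unless it lies in one block, where congruences modulo \<open>n\<close> become equations.\<close>

lemma avoids_mod_blocks:
  assumes \<tau>: "avoids_mod k (box 2 2) \<tau>" and "k \<ge> 3" "0 \<le> s" "0 \<le> t"
    and q: "n div k \<ge> s + t + 4 * k"
    and ex: "\<exists>\<sigma>. avoids_int (n div k) s t \<sigma>" "\<exists>\<sigma>. avoids_int (n div k + 1) s t \<sigma>"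
  shows "\<exists>\<pi>. avoids_mod n (box s t) \<pi>"
proof -
  define q \<rho> where "q = n div k" and "\<rho> = n mod k"
  have k: "k > 0" using assms by simp
  have nq: "n = k * q + \<rho>" and \<rho>: "0 \<le> \<rho>" "\<rho> < k"
    using k by (simp_all add: q_def \<rho>_def)
  have q: "s + 4 * k \<le> q" "t + 4 * k \<le> q" "q \<ge> 0" "s < q" "t < q"
    using assms by (simp_all add: q_def)
  define c where "c i = (if i < \<rho> then q + 1 else q)" for i
  have c: "c i \<in> {q, q + 1}" for i by (simp add: c_def)
  define D where "D i = sum c {0..<i}" for i
  have "{0..<k} = {0..<\<rho>} \<union> {\<rho>..<k}" using \<rho> by auto
  then have "sum c {0..<k} = sum c {0..<\<rho>} + sum c {\<rho>..<k}"
    by (simp add: sum.union_disjoint)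
  also have "\<dots> = n"
    using \<rho> nq by (simp add: c_def algebra_simps)
  finally have n: "sum c {0..<k} = n" .
  have \<alpha>: "bij_betw (\<lambda>(i, y). D i + y) (SIGMA i:{0..<k}. {0..<c i}) {0..<n}"
    using consecutive_blocks(1)[of "nat k" c q] c q k n by (simp add: D_def)
  have D: "q * j \<le> D j \<and> D j \<le> (q + 1) * j" if "j \<in> {0..<k}" for j
    using consecutive_blocks(2)[of "nat k" c q j] c q k that by (simp add: D_def)
  have "\<forall>i. \<exists>\<sigma>. avoids_int (c i) s t \<sigma>"
    using ex by (simp add: c_def q_def)
  then obtain \<sigma> where \<sigma>: "\<And>i. avoids_int (c i) s t (\<sigma> i)" by metis
  have "n \<ge> 0" using nq k q \<rho> by simp
  obtain \<pi> S where \<pi>: "bij_betw \<pi> {0..<n} {0..<n}"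
    and \<pi>_eq: "\<And>i y. i \<in> {0..<k} \<Longrightarrow> y \<in> {0..<c i} \<Longrightarrow> \<pi> (D i + y) = S (\<tau> i) + \<sigma> i y"
    and S: "\<And>j. j \<in> {0..<k} \<Longrightarrow> q * j \<le> S j \<and> S j \<le> (q + 1) * j"
    by (rule block_permutation[OF avoids_mod_bij[OF \<tau>] c \<alpha> avoids_int_bij[OF \<sigma>]])
      (use k \<open>n \<ge> 0\<close> q in auto)
  \<comment> \<open>Inside one block second differences are at most \<open>2 * q\<close> and the
    tolerances are below \<open>q\<close>, while \<open>n \<ge> 3 * q\<close>; this is where
    \<open>k \<ge> 3\<close> enters.\<close>
  have small: "\<bar>z\<bar> \<le> u" if z: "[z = \<eta>] (mod n)" "\<bar>z\<bar> \<le> 2 * q" "\<bar>\<eta>\<bar> \<le> u" "u < q" for z \<eta> u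
  proof -
    have "3 * q \<le> n" using nq \<rho> \<open>k \<ge> 3\<close> q mult_right_mono[of 3 k q] by simp
    then have "\<bar>z - \<eta>\<bar> < n" using z by linarith
    then have "z = \<eta>" using z(1) dvd_imp_le_int[of "z - \<eta>" n] by (auto simp: cong_iff_dvd_diff)
    with z show ?thesis by simp
  qed
  have AP: "a\<^sub>1 = a\<^sub>2 \<and> a\<^sub>2 = a\<^sub>3"
    if a: "a\<^sub>1 \<in> {0..<n}" "a\<^sub>2 \<in> {0..<n}" "a\<^sub>3 \<in> {0..<n}" and xy: "(\<eta>, \<theta>) \<in> box s t"
      and 1: "[a\<^sub>1 + a\<^sub>3 - 2 * a\<^sub>2 = \<eta>] (mod n)" and 2: "[\<pi> a\<^sub>1 + \<pi> a\<^sub>3 - 2 * \<pi> a\<^sub>2 = \<theta>] (mod n)"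
    for a\<^sub>1 a\<^sub>2 a\<^sub>3 \<eta> \<theta>
  proof -
    have xy: "\<bar>\<eta>\<bar> \<le> s" "\<bar>\<theta>\<bar> \<le> t" using xy by auto
    have "\<exists>i\<in>{0..<k}. \<exists>y\<in>{0..<c i}. a = D i + y" if "a \<in> {0..<n}" for a
      using that unfolding bij_betw_imp_surj_on[OF \<alpha>, symmetric] by auto
    with a obtain i\<^sub>1 i\<^sub>2 i\<^sub>3 y\<^sub>1 y\<^sub>2 y\<^sub>3 where
      i: "i\<^sub>1 \<in> {0..<k}" "i\<^sub>2 \<in> {0..<k}" "i\<^sub>3 \<in> {0..<k}" and
      y: "y\<^sub>1 \<in> {0..<c i\<^sub>1}" "y\<^sub>2 \<in> {0..<c i\<^sub>2}" "y\<^sub>3 \<in> {0..<c i\<^sub>3}" and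
      a_eq: "a\<^sub>1 = D i\<^sub>1 + y\<^sub>1" "a\<^sub>2 = D i\<^sub>2 + y\<^sub>2" "a\<^sub>3 = D i\<^sub>3 + y\<^sub>3" by metis
    have \<tau>i: "\<tau> i\<^sub>1 \<in> {0..<k}" "\<tau> i\<^sub>2 \<in> {0..<k}" "\<tau> i\<^sub>3 \<in> {0..<k}"
      using bij_betwE[OF avoids_mod_bij[OF \<tau>]] i by blast+
    have yq: "y \<in> {0..q}" if "y \<in> {0..<c i}" for i y
      using that c[of i] by force
    have \<sigma>y: "\<sigma> i y \<in> {0..q}" if "y \<in> {0..<c i}" for i y
      using bspec[OF bij_betwE[OF avoids_int_bij[OF \<sigma>[of i]]] that] by (rule yq)
    have \<pi>a: "\<pi> a\<^sub>1 = S (\<tau> i\<^sub>1) + \<sigma> i\<^sub>1 y\<^sub>1" "\<pi> a\<^sub>2 = S (\<tau> i\<^sub>2) + \<sigma> i\<^sub>2 y\<^sub>2"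
      "\<pi> a\<^sub>3 = S (\<tau> i\<^sub>3) + \<sigma> i\<^sub>3 y\<^sub>3"
      using \<pi>_eq i y a_eq by simp_all
    obtain d where d: "d \<in> {-2..2}" "[i\<^sub>1 + i\<^sub>3 - 2 * i\<^sub>2 = d] (mod k)"
      using block_second_difference[OF i D yq[OF y(1)] yq[OF y(2)] yq[OF y(3)] \<rho>
          \<open>0 \<le> s\<close> q(1) 1[unfolded nq a_eq] xy(1)] by blast
    obtain e where e: "e \<in> {-2..2}" "[\<tau> i\<^sub>1 + \<tau> i\<^sub>3 - 2 * \<tau> i\<^sub>2 = e] (mod k)"
      using block_second_difference[OF \<tau>i S \<sigma>y[OF y(1)] \<sigma>y[OF y(2)] \<sigma>y[OF y(3)] \<rho>
          \<open>0 \<le> t\<close> q(2) 2[unfolded nq \<pi>a] xy(2)] by blast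
    have ii: "i\<^sub>1 = i\<^sub>2 \<and> i\<^sub>2 = i\<^sub>3"
      using avoids_modD[OF \<tau> i _ d(2) e(2)] d(1) e(1) by auto
    have "\<bar>y\<^sub>1 + y\<^sub>3 - 2 * y\<^sub>2\<bar> \<le> s"
    proof (rule small[OF _ _ xy(1) q(4)])
      show "[y\<^sub>1 + y\<^sub>3 - 2 * y\<^sub>2 = \<eta>] (mod n)" using 1 ii by (simp add: a_eq)
      show "\<bar>y\<^sub>1 + y\<^sub>3 - 2 * y\<^sub>2\<bar> \<le> 2 * q"
        using yq[OF y(1)] yq[OF y(2)] yq[OF y(3)] by auto
    qed
    moreover have "\<bar>\<sigma> i\<^sub>1 y\<^sub>1 + \<sigma> i\<^sub>1 y\<^sub>3 - 2 * \<sigma> i\<^sub>1 y\<^sub>2\<bar> \<le> t"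
    proof (rule small[OF _ _ xy(2) q(5)])
      show "[\<sigma> i\<^sub>1 y\<^sub>1 + \<sigma> i\<^sub>1 y\<^sub>3 - 2 * \<sigma> i\<^sub>1 y\<^sub>2 = \<theta>] (mod n)" using 2 ii by (simp add: \<pi>a)
      show "\<bar>\<sigma> i\<^sub>1 y\<^sub>1 + \<sigma> i\<^sub>1 y\<^sub>3 - 2 * \<sigma> i\<^sub>1 y\<^sub>2\<bar> \<le> 2 * q"
        using \<sigma>y[OF y(1)] \<sigma>y[OF y(2)] \<sigma>y[OF y(3)] ii by auto
    qed
    moreover have "y\<^sub>1 \<in> {0..<c i\<^sub>1}" "y\<^sub>2 \<in> {0..<c i\<^sub>1}" "y\<^sub>3 \<in> {0..<c i\<^sub>1}"
      using y ii by simp_all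
    ultimately have "y\<^sub>1 = y\<^sub>2 \<and> y\<^sub>2 = y\<^sub>3"
      using avoids_intD[OF \<sigma>] by blast
    then show ?thesis using ii a_eq by simp
  qed
  have "avoids_mod n (box s t) \<pi>" by (rule avoids_modI[OF \<pi>], rule AP)
  then show ?thesis by blast
qed

section \<open>Arbitrary tolerances\<close>

text \<open>The tolerances grow from \<open>(0, 0)\<close> to \<open>(t, 0)\<close> by residue
  classes modulo \<open>k'\<close>, turn into \<open>(0, t)\<close> by inversion, and grow to
  \<open>(s, t)\<close> by residue classes modulo \<open>k\<close>.\<close>

lemma avoids_int_eventually:
  assumes \<tau>: "avoids_mod k (box s 2) \<tau>" "0 \<le> s" "s < k"
    and \<tau>': "avoids_mod k' (box t 2) \<tau>'" "0 \<le> t" "t < k'"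
  shows "\<exists>m1. \<forall>m\<ge>m1. \<exists>\<pi>. avoids_int m s t \<pi>"
proof -
  obtain m1 where "\<And>m. m \<ge> m1 \<Longrightarrow> \<exists>\<pi>. avoids_int m t 0 \<pi>"
    using avoids_int_residue_classes[OF \<tau>', of 0] avoids_int_0_0 by auto
  then have "\<exists>\<pi>. avoids_int m 0 t \<pi>" if "m \<ge> m1" for m
    using avoids_int_inv that by blast
  then show ?thesis
    using avoids_int_residue_classes[OF \<tau> \<open>0 \<le> t\<close>] by blast
qed

lemma avoids_mod_eventually:
  assumes \<tau>: "avoids_mod k (box 2 2) \<tau>" "k \<ge> 3" and "0 \<le> s" "0 \<le> t"
    and ex: "\<forall>m\<ge>m1. \<exists>\<pi>. avoids_int m s t \<pi>"
  shows "\<exists>n1. \<forall>n\<ge>n1. \<exists>\<pi>. avoids_mod n (box s t) \<pi>"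
proof (rule exI, intro allI impI)
  fix n assume n: "n \<ge> k * max m1 (s + t + 4 * k)"
  have "n div k \<ge> max m1 (s + t + 4 * k)"
    using zdiv_mono1[OF n, of k] \<open>k \<ge> 3\<close> by simp
  then show "\<exists>\<pi>. avoids_mod n (box s t) \<pi>"
    using avoids_mod_blocks[OF \<tau> \<open>0 \<le> s\<close> \<open>0 \<le> t\<close>, of n] ex by simp
qed

text \<open>Scaling domain and image by units takes each coordinate of the pair to \<open>0\<close> or \<open>1\<close>.\<close>

lemma avoids_mod_single_pair:
  assumes "prime p" "avoids_mod p ({0, 1} \<times> {0, 1}) \<pi>" "\<bar>f\<bar> < p" "\<bar>g\<bar> < p"
  shows "\<exists>\<rho>. avoids_mod p {(0, 0), (f, g)} \<rho>"
proof -
  have "p > 0" using assms(1) by (simp add: prime_gt_0_int)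
  have cop: "coprime x p" if "\<bar>x\<bar> < p" "x \<noteq> 0" for x
    using that assms(1) prime_imp_coprime[of p x] dvd_imp_le_int[of x p]
    by (auto simp: coprime_commute)
  have "\<exists>u. coprime u p \<and> (\<exists>x'\<in>{0, 1}. [u * f = x'] (mod p))"
  proof (cases "f = 0")
    case True
    then show ?thesis by (intro exI[of _ 1]) auto
  next
    case False
    then obtain u where "[f * u = 1] (mod p)"
      using cong_solve_coprime_int cop assms(3) by blast
    then show ?thesis
      by (intro exI[of _ u]) (auto simp: mult.commute coprime_iff_invertible_int)
  qed
  then obtain u x' where u: "coprime u p" "x' \<in> {0, 1}" "[u * f = x'] (mod p)" by blast
  \<comment> \<open>Values are scaled after \<open>\<pi>\<close> has acted, so the factor is
    \<open>g\<close> itself, which carries the difference 1 to \<open>g\<close>.\<close>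
  define v where "v = (if g = 0 then 1 else g)"
  define y' :: int where "y' = (if g = 0 then 0 else 1)"
  have v: "coprime v p" "v * y' = g" "y' \<in> {0, 1}" using cop assms(4) by (auto simp: v_def y'_def)
  have cancel: "[z = w] (mod p)" if "[v * z = v * w] (mod p)" for z w
    using that v(1) by (simp add: cong_mult_lcancel)
  have "avoids_mod p {(0, 0), (f, g)} (\<lambda>x. v * \<pi> (u * x mod p) mod p)"
  proof (rule avoids_mod_scale[OF assms(2) u(1) v(1) \<open>p > 0\<close>])
    fix x y assume "(x, y) \<in> {(0, 0), (f, g)}"
    then consider "x = 0" "y = 0" | "x = f" "y = g" by auto
    then show "\<exists>(x', y')\<in>{0, 1} \<times> {0, 1}. [u * x = x'] (mod p) \<and>
      (\<forall>z. [v * z = y] (mod p) \<longrightarrow> [z = y'] (mod p))"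
    proof cases
      case 1
      then show ?thesis using cancel[of _ 0] by (intro bexI[of _ "(0, 0)"]) auto
    next
      case 2
      then show ?thesis using u v cancel[of _ y'] by (intro bexI[of _ "(x', y')"]) auto
    qed
  qed
  then show ?thesis by blast
qed

text \<open>Each pair of \<open>F\<close> gets a prime factor of its own, whose permutation comes
  from the case \<open>box 2 2\<close>. Adding \<open>(0, 0)\<close> and keeping
  \<open>M > K\<close> maintain the hypotheses of the product lemma.\<close>

lemma avoids_mod_finite_set:
  fixes F :: "(int \<times> int) set"
  assumes ev: "\<And>n. n \<ge> n1 \<Longrightarrow> \<exists>\<pi>. avoids_mod n (box 2 2) \<pi>"
    and "finite F" and "F \<subseteq> box K K" and "K > 0"
  shows "\<exists>M>K. \<exists>\<pi>. avoids_mod M (insert (0, 0) F) \<pi>"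
  using assms(2,3)
proof (induction F)
  case empty
  obtain \<pi> where "avoids_mod (max n1 (K + 1)) (box 2 2) \<pi>" using ev[of "max n1 (K + 1)"] by auto
  then have "avoids_mod (max n1 (K + 1)) {(0, 0)} \<pi>" by (rule avoids_mod_mono) simp
  then show ?case by (intro exI[of _ "max n1 (K + 1)"]) auto
next
  case (insert e F)
  then obtain M \<pi> where M: "M > K" "avoids_mod M (insert (0, 0) F) \<pi>" by auto
  obtain f g where e: "e = (f, g)" and fg: "\<bar>f\<bar> \<le> K" "\<bar>g\<bar> \<le> K"
    using insert.prems by (cases e) auto
  \<comment> \<open>A prime above \<open>M\<close> is coprime to it and exceeds all entries of the
    pairs; being above \<open>n1\<close>, it also has a permutation for
    \<open>box 2 2\<close>.\<close>
  obtain p' :: nat where p': "prime p'" "p' > nat (max M n1)" using bigger_prime by blast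
  define p where "p = int p'"
  have p: "prime p" "p > M" "p \<ge> n1" using p' by (auto simp: p_def)
  obtain \<rho> where "avoids_mod p (box 2 2) \<rho>" using ev p by blast
  then have "avoids_mod p ({0, 1} \<times> {0, 1}) \<rho>" by (rule avoids_mod_mono) auto
  then obtain \<rho>' where \<rho>': "avoids_mod p {(0, 0), (f, g)} \<rho>'"
    using avoids_mod_single_pair[OF p(1)] fg p M by force
  have "\<exists>\<sigma>. avoids_mod (M * p) (insert (0, 0) F \<union> {(0, 0), (f, g)}) \<sigma>"
  proof (rule avoids_mod_product[OF _ _ _ M(2) \<rho>'])
    show "coprime M p"
      using p M \<open>K > 0\<close> prime_imp_coprime[of p M] zdvd_imp_le[of p M] by (auto simp: coprime_commute)
    show "\<bar>x\<bar> < M \<and> \<bar>y\<bar> < M" if "(x, y) \<in> insert (0, 0) F" for x y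
      using that insert.prems M \<open>K > 0\<close> by force
  qed (use p M fg \<open>K > 0\<close> in auto)
  moreover have "insert (0, 0) F \<union> {(0, 0), (f, g)} = insert (0, 0) (insert e F)"
    using e by auto
  moreover have "M * p > K"
  proof -
    have "K * 1 < M * p" using M p \<open>K > 0\<close> by (intro mult_strict_mono) auto
    then show ?thesis by simp
  qed
  ultimately show ?case by auto
qed

text \<open>A bootstrap: the single modulus 174420 yields \<open>box 2 2\<close> for all large
  moduli; products then give moduli for \<open>box s 2\<close> and \<open>box t 2\<close>. These
  settle integer intervals, and blocks over 174420 again settle all large \<open>n\<close>.\<close>

lemma avoids_mod_box_eventually:
  assumes "0 \<le> s" "0 \<le> t"
  shows "\<exists>n1. \<forall>n\<ge>n1. \<exists>\<pi>. avoids_mod n (box s t) \<pi>"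
proof -
  obtain \<tau> where \<tau>: "avoids_mod 174420 (box 2 2) \<tau>" using avoids_mod_base by blast
  obtain n1 where ev: "\<And>n. n \<ge> n1 \<Longrightarrow> \<exists>\<pi>. avoids_mod n (box 2 2) \<pi>"
  proof -
    obtain m1 where "\<forall>m\<ge>m1. \<exists>\<pi>. avoids_int m 2 2 \<pi>"
      using avoids_int_eventually[OF \<tau> _ _ \<tau>] by auto
    then have "\<exists>n1. \<forall>n\<ge>n1. \<exists>\<pi>. avoids_mod n (box 2 2) \<pi>"
      by (intro avoids_mod_eventually[OF \<tau>]) simp_all
    then show thesis using that by blast
  qed
  have "\<exists>k>u. \<exists>\<pi>. avoids_mod k (box u 2) \<pi>" if "0 \<le> u" for u
  proof -
    \<comment> \<open>\<open>u + 2\<close> bounds both coordinates of \<open>box u 2\<close> and is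
      positive.\<close>
    have "\<exists>k>u + 2. \<exists>\<pi>. avoids_mod k (insert (0, 0) (box u 2)) \<pi>"
      by (rule avoids_mod_finite_set[OF ev]) (use that in auto)
    then obtain k \<pi> where "k > u + 2" "avoids_mod k (insert (0, 0) (box u 2)) \<pi>" by blast
    moreover from this(2) have "avoids_mod k (box u 2) \<pi>" by (rule avoids_mod_mono) blast
    ultimately show ?thesis by (intro exI[of _ k]) auto
  qed
  note ex = this
  obtain k \<pi> where k: "s < k" "avoids_mod k (box s 2) \<pi>" using ex[OF assms(1)] by blast
  obtain k' \<pi>' where k': "t < k'" "avoids_mod k' (box t 2) \<pi>'" using ex[OF assms(2)] by blast
  obtain m1 where "\<forall>m\<ge>m1. \<exists>\<pi>. avoids_int m s t \<pi>"
    using avoids_int_eventually[OF k(2) assms(1) k(1) k'(2) assms(2) k'(1)] by blast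
  then show ?thesis
    by (rule avoids_mod_eventually[OF \<tau> _ assms, rotated]) simp
qed

theorem theorem1p1:
  shows "(\<forall>n::nat. n \<ge> (9 * 11 * 16 * 17 * 19 * 23)^2 \<longrightarrow>
            (\<exists>\<pi>. permutation_Zn n \<pi> \<and> destroys_APs n \<pi>)) \<and>
         (\<forall>s t :: nat. \<exists>n0 :: nat. \<forall>n \<ge> n0.
            \<exists>\<pi>. permutation_Zn n \<pi> \<and> destroys_almost_APs s t n \<pi>)"
proof (intro conjI allI impI)
  fix n :: nat
  assume "n \<ge> (9 * 11 * 16 * 17 * 19 * 23)^2"
  \<comment> \<open>With both tolerances 0, the blocks need a quotient of at least
    \<open>4 * 174420\<close>, that is \<open>n \<ge> 4 * 174420^2\<close>, about 1.2 *
    10^11.\<close>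
  then have n: "n > 0" "int n div 174420 \<ge> 4 * 174420" by simp_all
  obtain \<tau> where \<tau>: "avoids_mod 174420 (box 2 2) \<tau>" using avoids_mod_base by blast
  obtain \<pi> where \<pi>: "avoids_mod (int n) (box 0 0) \<pi>"
    using avoids_mod_blocks[OF \<tau>, of 0 0 "int n"] n avoids_int_0_0 by auto
  then show "\<exists>\<pi>. permutation_Zn n \<pi> \<and> destroys_APs n \<pi>"
    using avoids_mod_imp_destroys[of n 0 0 \<pi>] n destroys_almost_APs_0_imp_destroys_APs by auto
next
  fix s t :: nat
  obtain n1 where "\<And>n. n \<ge> n1 \<Longrightarrow> \<exists>\<pi>. avoids_mod n (box (int s) (int t)) \<pi>"
    using avoids_mod_box_eventually[of "int s" "int t"] by auto
  \<comment> \<open>The bound 1 excludes \<open>n = 0\<close>, where the carrier is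
    infinite.\<close>
  then have "\<exists>\<pi>. permutation_Zn n \<pi> \<and> destroys_almost_APs s t n \<pi>" if "n \<ge> max 1 (nat n1)" for n
    using avoids_mod_imp_destroys[of n s t] that by (metis less_le_trans max.bounded_iff nat_le_iff zero_less_one)
  then show "\<exists>n0. \<forall>n \<ge> n0. \<exists>\<pi>. permutation_Zn n \<pi> \<and> destroys_almost_APs s t n \<pi>"
    by blast
qed

end
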